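(* The set of compound marker endomorphisms of $\Sigma_2=\{A,B\}^{\mathbb{Z}}$ is equal to $P_\infty$, where $P_\infty$ is the set of all maps $f_\infty:\Sigma_2\to\Sigma_2$ arising from some $n\in\mathbb{N}$ and some $f:\{A,B\}^{2n+1}\to\{A,B\}$ that is permutive in $x_0$.
   Context: $\Sigma_2=\{A,B\}^{\mathbb{Z}}$; $\mathbb{N}$ contains $0$. Write $\tilde A=B$, $\tilde B=A$. Compound marker endomorphism: let $S_1,\dots,S_k$ be a finite (possibly empty) list of finite words on $\{A,B,*\}$, each containing exactly one $*$; write $S_i=\alpha_i*\omega_i$ with $\alpha_i,\omega_i$ finite (possibly empty) words on $\{A,B\}$. The associated compound marker endomorphism $\phi:\Sigma_2\to\Sigma_2$ is defined, for $c=(c_l)_{l\in\mathbb{Z}}$ and $l\in\mathbb{Z}$, by $\phi(c)_l=\tilde{c_l}$ if there is at least one $i\in\{1,\dots,k\}$ such that $c_{l-|\alpha_i|}\cdots c_{l-1}=\alpha_i$ and $c_{l+1}\cdots c_{l+|\omega_i|}=\omega_i$, and $\phi(c)_l=c_l$ otherwise (all swaps are performed simultaneously, according to the matches in $c$). For the empty list, $\phi$ is the identity. For $n\in\mathbb{N}$, $F(n)$ is the set of functions $f:\{A,B\}^{2n+1}\to\{A,B\}$, with the variables written $x_{-n},\dots,x_n$. For $f\in F(n)$, define $f_\infty:\Sigma_2\to\Sigma_2$ by $f_\infty((x_k)_{k\in\mathbb{Z}})=(f(x_{k-n},\dots,x_{k+n}))_{k\in\mathbb{Z}}$. For an integer $i$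 with $-n\le i\le n$, $f\in F(n)$ is permutive in $x_i$ if for all $x_{-n},\dots,x_{i-1},x_{i+1},\dots,x_n\in\{A,B\}$ the map $g:\{A,B\}\to\{A,B\}$, $g(s)=f(x_{-n},\dots,x_{i-1},s,x_{i+1},\dots,x_n)$, is bijective. *)

theory Defs
  imports Main "HOL-Library.FuncSet"
begin

datatype letter = A | B

fun swap_letter :: "letter \<Rightarrow> letter" where
  "swap_letter A = B"
| "swap_letter B = A"

type_synonym config = "int \<Rightarrow> letter"

datatype marker_symbol = Letter letter | Star

type_synonym marker = "marker_symbol list"

definition is_marker :: "marker \<Rightarrow> bool" where
  "is_marker S \<longleftrightarrow> count_list S Star = 1"

definition occurs_at :: "letter list \<Rightarrow> config \<Rightarrow> int \<Rightarrow> bool" where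
  "occurs_at w c m \<longleftrightarrow> (\<forall>j < length w. c (m + int j) = w ! j)"

(* The star of S sits over position l. If S is a marker, its decomposition
   into \<alpha> and \<omega> exists and is unique. *)
definition marker_matches :: "marker \<Rightarrow> config \<Rightarrow> int \<Rightarrow> bool" where
  "marker_matches S c l \<longleftrightarrow>
     (\<exists>\<alpha> \<omega>. S = map Letter \<alpha> @ [Star] @ map Letter \<omega> \<and>
            occurs_at \<alpha> c (l - int (length \<alpha>)) \<and> occurs_at \<omega> c (l + 1))"

definition marker_map :: "marker list \<Rightarrow> config \<Rightarrow> config" where
  "marker_map Ss c =
     (\<lambda>l. if \<exists>S \<in> set Ss. marker_matches S c l then swap_letter (c l) else c l)"

definition compound_marker_endomorphisms :: "(config \<Rightarrow> config) set" where
  "compound_marker_endomorphisms = {marker_map Ss | Ss. \<forall>S \<in> set Ss. is_marker S}"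

(* A tuple (x_{-n}, ..., x_n) is an extensional function on {-n..n},
   i.e. one that is undefined outside that interval. *)
definition window :: "nat \<Rightarrow> int set" where
  "window n = {- int n..int n}"

definition local_rules :: "nat \<Rightarrow> ((int \<Rightarrow> letter) \<Rightarrow> letter) set" where
  "local_rules n = (window n \<rightarrow>\<^sub>E (UNIV :: letter set)) \<rightarrow>\<^sub>E (UNIV :: letter set)"

definition induced_map :: "nat \<Rightarrow> ((int \<Rightarrow> letter) \<Rightarrow> letter) \<Rightarrow> config \<Rightarrow> config" where
  "induced_map n f x = (\<lambda>k. f (\<lambda>i \<in> window n. x (k + i)))"

(* Only meaningful for i in window n: x ranges over the values of the
   variables other than x_i. *)
definition permutive_in :: "nat \<Rightarrow> int \<Rightarrow> ((int \<Rightarrow> letter) \<Rightarrow> letter) \<Rightarrow> bool" where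
  "permutive_in n i f \<longleftrightarrow>
     (\<forall>x \<in> (window n - {i}) \<rightarrow>\<^sub>E (UNIV :: letter set). bij (\<lambda>s. f (x(i := s))))"

definition P_infty :: "(config \<Rightarrow> config) set" where
  "P_infty = {induced_map n f | n f. f \<in> local_rules n \<and> permutive_in n 0 f}"

end

theory Submission
  imports Defs
begin

text \<open>
  A two-letter alphabet has exactly two permutations, the identity and the swap. So a local rule
  that is permutive in its centre variable does nothing more than decide, from the other letters of
  its window, whether to keep or to swap the centre letter. A list of markers makes the same kind
  of decision, since the star exempts the centre from the match.

  From markers to rules: whether a marker matches depends only on the letters around the star and
  within the length of the marker (\<open>marker_matches_cong\<close>). On a window whose radius is at least
  the length of every marker, the rule that evaluates the marker map at the origin thus induces
  this map, and its dependence on the centre letter is the identity or the swap.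

  From rules to markers: a full context, that is, an assignment of letters to all noncentral
  positions of the window, is the same thing as a marker with the star in the middle, and the
  marker matches exactly where the context appears (\<open>marker_matches_context_marker\<close>). There are
  finitely many contexts; the markers of those in which the rule swaps form the required list.
\<close>

lemma marker_matches_decomposed:
  "marker_matches (map Letter \<alpha> @ [Star] @ map Letter \<omega>) c l \<longleftrightarrow>
     occurs_at \<alpha> c (l - int (length \<alpha>)) \<and> occurs_at \<omega> c (l + 1)"
proof -
  have "map Letter \<alpha> @ Star # map Letter \<omega> = map Letter \<alpha>' @ Star # map Letter \<omega>' \<longleftrightarrow>
          \<alpha> = \<alpha>' \<and> \<omega> = \<omega>'" for \<alpha>' \<omega>'
    by (subst append_Cons_eq_iff) (auto simp: inj_map_eq_map inj_def)
  then show ?thesis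
    unfolding marker_matches_def by auto
qed

text \<open>Leaving out offset \<open>0\<close> is what makes the induced rules permutive in the centre variable,
  and having two base points \<open>l\<close> and \<open>m\<close> makes shift invariance part of the same statement.\<close>

lemma marker_matches_cong:
  assumes agree: "\<And>i. i \<in> window n - {0} \<Longrightarrow> c (l + i) = d (m + i)"
    and len: "length S \<le> n"
  shows "marker_matches S c l \<longleftrightarrow> marker_matches S d m"
proof (cases "\<exists>\<alpha> \<omega>. S = map Letter \<alpha> @ [Star] @ map Letter \<omega>")
  case True
  then obtain \<alpha> \<omega> where S: "S = map Letter \<alpha> @ [Star] @ map Letter \<omega>" by blast
  have left: "c (l - int (length \<alpha>) + int j) = d (m - int (length \<alpha>) + int j)"
    if "j < length \<alpha>" for j
    using agree[of "int j - int (length \<alpha>)"] that len by (simp add: S window_def algebra_simps)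
  have right: "c (l + 1 + int j) = d (m + 1 + int j)" if "j < length \<omega>" for j
    using agree[of "1 + int j"] that len by (simp add: S window_def algebra_simps)
  show ?thesis
    unfolding S marker_matches_decomposed occurs_at_def using left right by simp
next
  case False
  then show ?thesis unfolding marker_matches_def by blast
qed

lemma bij_swap_letter: "bij swap_letter"
proof (rule involuntory_imp_bij)
  show "swap_letter (swap_letter s) = s" for s by (cases s) auto
qed

lemma bij_letter_cases:
  assumes "bij g"
  shows "g s = (if g A = B then swap_letter s else s)"
proof -
  have "g A \<noteq> g B"
    using assms by (metis bij_is_inj inj_eq letter.distinct(1))
  then show ?thesis
    by (metis (full_types) letter.exhaust swap_letter.simps)
qed

lemma marker_map_in_P_infty: "marker_map Ss \<in> P_infty"
proof -
  define n where "n = sum_list (map length Ss)"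
  have len: "length S \<le> n" if "S \<in> set Ss" for S
    unfolding n_def using that by (intro member_le_sum_list) auto
  define f where "f = (\<lambda>y \<in> window n \<rightarrow>\<^sub>E UNIV. marker_map Ss y 0)"
  have "f \<in> local_rules n"
    by (simp add: f_def local_rules_def)
  moreover have "permutive_in n 0 f"
    unfolding permutive_in_def
  proof
    fix x :: config
    assume x: "x \<in> window n - {0} \<rightarrow>\<^sub>E UNIV"
    define swaps where "swaps \<longleftrightarrow> (\<exists>S \<in> set Ss. marker_matches S x 0)"
    have "f (x(0 := s)) = (if swaps then swap_letter s else s)" for s
    proof -
      have "x(0 := s) \<in> window n \<rightarrow>\<^sub>E UNIV"
        using x by (auto simp: PiE_iff extensional_def window_def)
      moreover have "marker_matches S (x(0 := s)) 0 \<longleftrightarrow> marker_matches S x 0"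
        if "S \<in> set Ss" for S
        by (rule marker_matches_cong[OF _ len[OF that]]) simp
      ultimately show ?thesis
        by (simp add: f_def marker_map_def swaps_def)
    qed
    then have "(\<lambda>s. f (x(0 := s))) = (if swaps then swap_letter else (\<lambda>s. s))"
      by auto
    then show "bij (\<lambda>s. f (x(0 := s)))"
      using bij_swap_letter by (simp add: bij_id[unfolded id_def])
  qed
  moreover have "marker_map Ss = induced_map n f"
  proof (intro ext)
    fix c k
    have "marker_matches S (\<lambda>i \<in> window n. c (k + i)) 0 \<longleftrightarrow> marker_matches S c k"
      if "S \<in> set Ss" for S
      by (rule marker_matches_cong[OF _ len[OF that]]) simp
    moreover have "0 \<in> window n"
      by (simp add: window_def)
    ultimately show "marker_map Ss c k = induced_map n f c k"
      by (simp add: induced_map_def f_def marker_map_def)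
  qed
  ultimately show ?thesis
    unfolding P_infty_def by blast
qed

definition context_marker :: "nat \<Rightarrow> (int \<Rightarrow> letter) \<Rightarrow> marker" where
  "context_marker n x =
     map Letter (map (\<lambda>j. x (int j - int n)) [0..<n]) @ [Star] @
     map Letter (map (\<lambda>j. x (1 + int j)) [0..<n])"

lemma is_marker_context_marker: "is_marker (context_marker n x)"
proof -
  have "count_list (map Letter w) Star = 0" for w
    by (induction w) auto
  then show ?thesis
    by (simp add: is_marker_def context_marker_def del: map_map)
qed

lemma window_minus_centre:
  "window n - {0} = (\<lambda>j. int j - int n) ` {..<n} \<union> (\<lambda>j. 1 + int j) ` {..<n}"
proof (intro equalityI subsetI)
  fix i assume i: "i \<in> window n - {0}"
  show "i \<in> (\<lambda>j. int j - int n) ` {..<n} \<union> (\<lambda>j. 1 + int j) ` {..<n}"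
  proof (cases "i < 0")
    case True
    then have "i = int (nat (i + int n)) - int n" "nat (i + int n) < n"
      using i by (auto simp: window_def)
    then show ?thesis by blast
  next
    case False
    then have "i = 1 + int (nat (i - 1))" "nat (i - 1) < n"
      using i by (auto simp: window_def)
    then show ?thesis by blast
  qed
qed (auto simp: window_def)

lemma marker_matches_context_marker:
  "marker_matches (context_marker n x) c l \<longleftrightarrow> (\<forall>i \<in> window n - {0}. c (l + i) = x i)"
  unfolding context_marker_def marker_matches_decomposed window_minus_centre ball_Un
  by (auto simp: occurs_at_def algebra_simps)

lemma induced_map_is_marker_map:
  assumes perm: "permutive_in n 0 f"
  shows "induced_map n f \<in> compound_marker_endomorphisms"
proof -
  define swapping where
    "swapping = {x \<in> window n - {0} \<rightarrow>\<^sub>E (UNIV :: letter set). f (x(0 := A)) = B}"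
  have "(UNIV :: letter set) = {A, B}"
    using letter.exhaust by auto
  then have "finite (UNIV :: letter set)"
    by (rule finite_subset[OF equalityD1]) simp
  then have "finite (window n - {0} \<rightarrow>\<^sub>E (UNIV :: letter set))"
    by (intro finite_PiE) (simp_all add: window_def)
  then have "finite (context_marker n ` swapping)"
    by (simp add: swapping_def)
  then obtain Ss where Ss: "set Ss = context_marker n ` swapping"
    by (metis finite_list)
  have "induced_map n f = marker_map Ss"
  proof (intro ext)
    fix c :: config and l :: int
    define x where "x = (\<lambda>i \<in> window n - {0}. c (l + i))"
    have x: "x \<in> window n - {0} \<rightarrow>\<^sub>E UNIV"
      by (simp add: x_def)
    have "(\<forall>i \<in> window n - {0}. c (l + i) = x' i) \<longleftrightarrow> x' = x" if "x' \<in> swapping" for x'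
    proof
      assume "\<forall>i \<in> window n - {0}. c (l + i) = x' i"
      moreover have "x' \<in> window n - {0} \<rightarrow>\<^sub>E UNIV"
        using that by (simp add: swapping_def)
      ultimately show "x' = x"
        by (intro PiE_ext[OF _ x]) (auto simp: x_def)
    qed (simp add: x_def)
    then have match: "(\<exists>S \<in> set Ss. marker_matches S c l) \<longleftrightarrow> x \<in> swapping"
      unfolding Ss bex_simps marker_matches_context_marker by blast
    have "(\<lambda>i \<in> window n. c (l + i)) = x(0 := c l)"
      by (auto simp: x_def window_def)
    then have "induced_map n f c l = f (x(0 := c l))"
      by (simp add: induced_map_def)
    also have "\<dots> = (if f (x(0 := A)) = B then swap_letter (c l) else c l)"
      using perm x unfolding permutive_in_def by (intro bij_letter_cases) blast
    also have "\<dots> = marker_map Ss c l"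
      using x by (simp add: marker_map_def match swapping_def)
    finally show "induced_map n f c l = marker_map Ss c l" .
  qed
  moreover have "\<forall>S \<in> set Ss. is_marker S"
    using Ss is_marker_context_marker by auto
  ultimately show ?thesis
    unfolding compound_marker_endomorphisms_def by blast
qed

theorem theorem6p4:
  shows "compound_marker_endomorphisms = P_infty"
proof
  show "compound_marker_endomorphisms \<subseteq> P_infty"
    using marker_map_in_P_infty by (auto simp: compound_marker_endomorphisms_def)
  show "P_infty \<subseteq> compound_marker_endomorphisms"
    using induced_map_is_marker_map by (auto simp: P_infty_def)
qed

end
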